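(* Let $b>0$, $\sigma>0$, $\alpha,\beta>-1$, $\eta\in\mathbb{R}$, $\mu>0$ with $\beta-\mu>-1$, and let $N\ge0$ be an integer. Let $x_r:=x_r^{(\alpha,\beta,\sigma)}$, $r=0,\dots,N$, be the mapped Gauss–Jacobi nodes. Define $(N+1)\times(N+1)$ matrices ${}^L\mathbf{V}=({}^lv_{k,i})$ and ${}^L\mathbf{U}=({}^lu_{k,i})$, $k,i=0,\dots,N$, by $${}^lv_{k,i}={}^1\mathcal{J}_i^{(\alpha,\beta,\mu,\sigma,\eta)}(x_k),\qquad {}^lu_{k,i}=\frac{\Gamma(i+\beta+1)}{\Gamma(i+\beta-\mu+1)}\;{}^1\mathcal{J}_i^{(\alpha+\mu,\beta-\mu,\mu,\sigma,\eta-\mu)}(x_k).$$ Then ${}^L\mathbf{V}$ is invertible and the left-sided Erdélyi–Kober fractional differentiation matrix of order $\mu$, i.e. the matrix ${}^L_S\mathbf{D}^\mu=({}^l_sd_{k,i})$ with $${}_0D^\mu_{x,\sigma,\eta}\left[\mathcal{I}_{1,N}v\right](x_k)=\sum_{i=0}^N {}^l_sd_{k,i}\,v(x_i),\qquad k=0,\dots,N,$$ for every continuous function $v$ on $(0,b)$, is given by $${}^L_S\mathbf{D}^\mu={}^L\mathbf{U}\;{}^L\mathbf{V}^{-1}.$$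
   Context: $P_n^{(\alpha,\beta)}$ is the Jacobi polynomial of degree $n$ in the standard normalization $P_n^{(\alpha,\beta)}(1)=\binom{n+\alpha}{n}$. Let $x_r^{(\alpha,\beta)}\in(-1,1)$, $r=0,\dots,N$, be the zeros of $P_{N+1}^{(\alpha,\beta)}$ (Gauss–Jacobi nodes); the mapped nodes are $x_r^{(\alpha,\beta,\sigma)}=b\left(\frac{1+x_r^{(\alpha,\beta)}}2\right)^{1/\sigma}$. Jacobi–Müntz functions of the first kind: ${}^1\mathcal{J}_n^{(\alpha,\beta,\mu,\sigma,\eta)}(x)=x^{\sigma(\beta-\eta-\mu)}P_n^{(\alpha,\beta)}\left(2(x/b)^\sigma-1\right)$. Interpolant: $\mathcal{I}_{1,N}v(x)=\sum_{i=0}^N v(x_i)\left(\frac{x}{x_i}\right)^{\sigma(\beta-\eta-\mu)}h_i^\sigma(x)$ with $h_i^\sigma(x)=\prod_{j\ne i}\frac{x^\sigma-x_j^\sigma}{x_i^\sigma-x_j^\sigma}$. Left Erdélyi–Kober fractional integral (for $\nu>0$) and derivative (for $n-1<\mu\le n$, $n\in\mathbb{N}$): $${}_0I^\nu_{x,\sigma,\eta}[f](x)=\frac{\sigma x^{-\sigma(\eta+\nu)}}{\Gamma(\nu)}\int_0^x(x^\sigma-t^\sigma)^{\nu-1}t^{\sigma(\eta+1)-1}f(t)\,dt,$$ $${}_0D^\mu_{x,\sigma,\eta}[f](x)=x^{-\sigma\eta}\left(\frac1{\sigma x^{\sigma-1}}\frac{d}{dx}\right)^n x^{\sigma(\eta+n)}\,{}_0I^{n-\mu}_{x,\sigma,\eta+\mu}[f](x),$$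 with ${}_0I^0$ the identity. *)

theory Defs
  imports
    "HOL-Analysis.Analysis"
    "HOL-Computational_Algebra.Polynomial"
    "Jordan_Normal_Form.Matrix"
    "Jordan_Normal_Form.Gauss_Jordan_Elimination"
begin

text \<open>
  Jacobi polynomial, as
  \<open>P\<^sub>n(x) = (\<Sum>s\<le>n. C(n + \<alpha>, n - s) C(n + \<beta>, s) ((x - 1)/2)^s ((x + 1)/2)^(n - s))\<close>
  (Szego, Orthogonal Polynomials, (4.3.2)).
\<close>

definition jacobi_poly :: "nat \<Rightarrow> real \<Rightarrow> real \<Rightarrow> real poly" where
  "jacobi_poly n \<alpha> \<beta> =
     (\<Sum>s\<le>n. Polynomial.smult (((real n + \<alpha>) gchoose (n - s)) * ((real n + \<beta>) gchoose s))
               ([:- 1 / 2, 1 / 2:] ^ s * [:1 / 2, 1 / 2:] ^ (n - s)))"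

lemma poly_jacobi_poly:
  "poly (jacobi_poly n \<alpha> \<beta>) x =
     (\<Sum>s\<le>n. ((real n + \<alpha>) gchoose (n - s)) * ((real n + \<beta>) gchoose s)
               * ((x - 1) / 2) ^ s * ((x + 1) / 2) ^ (n - s))"
  by (simp add: jacobi_poly_def poly_sum diff_divide_distrib add_divide_distrib
      algebra_simps)

lemma jacobi_poly_normalization: "poly (jacobi_poly n \<alpha> \<beta>) 1 = (real n + \<alpha>) gchoose n"
  unfolding poly_jacobi_poly by (subst sum.mono_neutral_right[of _ "{0}"]) auto

definition jacobi_muentz1 ::
    "real \<Rightarrow> nat \<Rightarrow> real \<Rightarrow> real \<Rightarrow> real \<Rightarrow> real \<Rightarrow> real \<Rightarrow> real \<Rightarrow> real" where
  "jacobi_muentz1 b n \<alpha> \<beta> \<mu> \<sigma> \<eta> x =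
     x powr (\<sigma> * (\<beta> - \<eta> - \<mu>)) * poly (jacobi_poly n \<alpha> \<beta>) (2 * (x / b) powr \<sigma> - 1)"

definition lagrange_muentz :: "real \<Rightarrow> nat \<Rightarrow> (nat \<Rightarrow> real) \<Rightarrow> nat \<Rightarrow> real \<Rightarrow> real" where
  "lagrange_muentz \<sigma> N xs i x =
     (\<Prod>j\<in>{0..N} - {i}. (x powr \<sigma> - xs j powr \<sigma>) / (xs i powr \<sigma> - xs j powr \<sigma>))"

definition interpolant1 ::
    "real \<Rightarrow> real \<Rightarrow> real \<Rightarrow> real \<Rightarrow> nat \<Rightarrow> (nat \<Rightarrow> real) \<Rightarrow> (real \<Rightarrow> real) \<Rightarrow> real \<Rightarrow> real" where
  "interpolant1 \<beta> \<mu> \<sigma> \<eta> N xs v x =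
     (\<Sum>i=0..N. v (xs i) * (x / xs i) powr (\<sigma> * (\<beta> - \<eta> - \<mu>)) * lagrange_muentz \<sigma> N xs i x)"

definition EK_integral :: "real \<Rightarrow> real \<Rightarrow> real \<Rightarrow> (real \<Rightarrow> real) \<Rightarrow> real \<Rightarrow> real" where
  "EK_integral \<sigma> \<eta> \<nu> f x =
     (if \<nu> = 0 then f x
      else \<sigma> * x powr (- \<sigma> * (\<eta> + \<nu>)) / Gamma \<nu> *
        (LBINT t:{0..x}. (x powr \<sigma> - t powr \<sigma>) powr (\<nu> - 1) * t powr (\<sigma> * (\<eta> + 1) - 1) * f t))"

text \<open>
  For \<open>\<mu> > 0\<close> the integer \<open>n\<close> with \<open>n - 1 < \<mu> \<le> n\<close> is \<open>\<lceil>\<mu>\<rceil>\<close>.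
\<close>

definition EK_derivative :: "real \<Rightarrow> real \<Rightarrow> real \<Rightarrow> (real \<Rightarrow> real) \<Rightarrow> real \<Rightarrow> real" where
  "EK_derivative \<sigma> \<eta> \<mu> f x =
     (let n = nat \<lceil>\<mu>\<rceil> in
        x powr (- \<sigma> * \<eta>) *
        ((\<lambda>g y. 1 / (\<sigma> * y powr (\<sigma> - 1)) * deriv g y) ^^ n)
          (\<lambda>y. y powr (\<sigma> * (\<eta> + real n)) * EK_integral \<sigma> (\<eta> + \<mu>) (real n - \<mu>) f y) x)"

end

theory Submission
  imports Defs "Jordan_Normal_Form.Determinant"
begin

text \<open>
  Write \<open>p\<^sub>n(y) = P\<^sub>n(2 y - 1)\<close>. Differentiating
  \<open>(1 - y)\<^sup>\<alpha>\<^sup>+\<^sup>1 y\<^sup>\<beta>\<^sup>+\<^sup>1 p\<^sub>k\<close> with parameters \<open>\<alpha> + 1\<close>, \<open>\<beta> + 1\<close> gives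
  \<open>- (k + 1) (1 - y)\<^sup>\<alpha> y\<^sup>\<beta> p\<^sub>k\<^sub>+\<^sub>1\<close> with parameters \<open>\<alpha>\<close>, \<open>\<beta>\<close>, so induction with Rolle's
  theorem yields \<open>n\<close> distinct zeros of \<open>p\<^sub>n\<close> in \<open>(0, 1)\<close>; hence the nodes are distinct and \<open>V\<close> is
  invertible, since \<open>p\<^sub>n\<close> has exact degree \<open>n\<close>. The interpolant is the unique combination of
  Jacobi-Muentz functions with the given nodal values. The Erdelyi-Kober derivative multiplies
  \<open>x powr (\<sigma> * d)\<close> by \<open>\<Gamma>(d + \<eta> + \<mu> + 1) / \<Gamma>(d + \<eta> + 1)\<close>, which turns the expansion of \<open>p\<^sub>n\<close> at \<open>0\<close> into a
  multiple of the one with parameters \<open>\<alpha> + \<mu>\<close>, \<open>\<beta> - \<mu>\<close>.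
\<close>

section \<open>Zeros and expansion of Jacobi polynomials\<close>

text \<open>The induction removes the largest point of \<open>Z\<close>: Rolle between the two
  largest points yields one more zero, above all those found for the rest. The strict bounds by
  \<open>Min Z\<close> and \<open>Max Z\<close> make this count work and later keep the zeros off
  the endpoints, where \<open>f\<close> is only assumed continuous.\<close>

lemma Rolle_card:
  fixes f f' :: "real \<Rightarrow> real"
  assumes "finite Z" "card Z = Suc m" "Z \<subseteq> {lo..hi}" "\<And>y. y \<in> Z \<Longrightarrow> f y = 0"
    and cont: "continuous_on {lo..hi} f"
    and deriv: "\<And>y. lo < y \<Longrightarrow> y < hi \<Longrightarrow> (f has_real_derivative f' y) (at y)"
  shows "\<exists>W. finite W \<and> card W = m \<and> W \<subseteq> {Min Z<..<Max Z} \<and> (\<forall>w\<in>W. f' w = 0)"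
  using assms(1-4)
proof (induction m arbitrary: Z)
  case 0
  then show ?case by (intro exI[of _ "{}"]) auto
next
  case (Suc m)
  define z where "z = Max Z"
  define Z' where "Z' = Z - {z}"
  have zZ: "z \<in> Z" using Suc.prems unfolding z_def by (intro Max_in) auto
  have Z': "finite Z'" "card Z' = Suc m" using Suc.prems zZ by (auto simp: Z'_def)
  hence ne: "Z' \<noteq> {}" by auto
  define u where "u = Max Z'"
  have u: "u \<in> Z'" unfolding u_def using Z'(1) ne by (rule Max_in)
  have "u < z" using u Suc.prems(1) by (auto simp: Z'_def z_def intro: le_neq_trans)
  obtain W where W: "finite W" "card W = m" "W \<subseteq> {Min Z'<..<Max Z'}" "\<forall>w\<in>W. f' w = 0"
    using Suc.IH[OF Z'] Suc.prems(3,4) by (auto simp: Z'_def)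
  have "lo \<le> u" "z \<le> hi" "u \<in> Z" using u zZ Suc.prems(3) by (auto simp: Z'_def)
  have "\<exists>w. u < w \<and> w < z \<and> (f has_real_derivative 0) (at w)"
  proof (rule Rolle)
    show "u < z" by fact
    show "f u = f z" using Suc.prems(4) \<open>u \<in> Z\<close> zZ by simp
    show "continuous_on {u..z} f"
      by (rule continuous_on_subset[OF cont]) (use \<open>lo \<le> u\<close> \<open>z \<le> hi\<close> in auto)
    show "f differentiable at x" if "u < x" "x < z" for x
      using deriv[of x] that \<open>lo \<le> u\<close> \<open>z \<le> hi\<close> real_differentiable_def by force
  qed
  then obtain w where w: "u < w" "w < z" "(f has_real_derivative 0) (at w)" by blast
  hence "f' w = 0"
    using deriv[of w] \<open>lo \<le> u\<close> \<open>z \<le> hi\<close> DERIV_unique by force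
  have "Min Z \<le> Min Z'" using Z'(1) ne Suc.prems(1) by (intro Min_antimono) (auto simp: Z'_def)
  moreover have "Min Z' \<le> u" using u Z'(1) by simp
  ultimately have "Min Z \<le> u" "\<And>y. y \<in> W \<Longrightarrow> Min Z < y \<and> y < u"
    using W(3) unfolding u_def by force+
  then have "w \<notin> W" "insert w W \<subseteq> {Min Z<..<Max Z}"
    using w \<open>u < z\<close> unfolding z_def by force+
  then show ?case
    using W(1,2,4) \<open>f' w = 0\<close> by (intro exI[of _ "insert w W"]) simp
qed

lemma poly_jacobi_poly_unit:
  "poly (jacobi_poly n \<alpha> \<beta>) (2 * y - 1) =
     (\<Sum>s\<le>n. ((real n + \<alpha>) gchoose (n - s)) * ((real n + \<beta>) gchoose s)
               * (y - 1) ^ s * y ^ (n - s))"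
proof -
  have "(2 * y - 1 - 1) / 2 = y - 1" "(2 * y - 1 + 1) / 2 = y" by (auto simp: field_simps)
  then show ?thesis unfolding poly_jacobi_poly by (simp only:)
qed

lemma powr_mult_power: "x powr a * x ^ n = x powr (a + real n)" if "x > 0" for x a :: real
  using that by (simp add: powr_realpow powr_add)

text \<open>A recursion of Rodrigues type. Absorbing the weight turns each summand into a product of
  real powers, whose derivative consists of two neighbouring terms; by binomial absorption the
  contributions to each term add up to \<open>- (k + 1)\<close> times the coefficient in the next
  Jacobi polynomial.\<close>

lemma has_real_derivative_weighted_jacobi:
  assumes y: "0 < y" "y < 1"
  shows "((\<lambda>y. (1 - y) powr (\<alpha> + 1) * y powr (\<beta> + 1) *
             poly (jacobi_poly k (\<alpha> + 1) (\<beta> + 1)) (2 * y - 1))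
           has_real_derivative
           - (real k + 1) * ((1 - y) powr \<alpha> * y powr \<beta>) *
             poly (jacobi_poly (Suc k) \<alpha> \<beta>) (2 * y - 1)) (at y)"
proof -
  define A where "A s = ((real k + (\<alpha> + 1)) gchoose (k - s)) * ((real k + (\<beta> + 1)) gchoose s)" for s
  define B where "B s = ((real (Suc k) + \<alpha>) gchoose (Suc k - s)) * ((real (Suc k) + \<beta>) gchoose s)" for s
  \<comment> \<open>\<open>S\<close> and \<open>T\<close> are the summands for \<open>k\<close> and
    \<open>Suc k\<close> with the weight absorbed; \<open>(y - 1) ^ s\<close> is split into a sign
    and a power of the positive number \<open>1 - y\<close>.\<close>
  define T where "T s y = (- 1) ^ s * (1 - y) powr (\<alpha> + real s) * y powr (\<beta> + real (Suc k) - real s)"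
    for s and y :: real
  define S where "S s y = (- 1) ^ s * (1 - y) powr (\<alpha> + 1 + real s) * y powr (\<beta> + 1 + real k - real s)"
    for s and y :: real
  have pm: "(t - 1) ^ s = (- 1) ^ s * (1 - t) ^ s" for t :: real and s
    by (simp add: power_mult_distrib[symmetric])
  have eqS: "(1 - t) powr (\<alpha> + 1) * t powr (\<beta> + 1) * poly (jacobi_poly k (\<alpha> + 1) (\<beta> + 1)) (2 * t - 1)
      = (\<Sum>s\<le>k. A s * S s t)" if t: "t \<in> {0<..<1}" for t
    unfolding poly_jacobi_poly_unit sum_distrib_left
  proof (rule sum.cong[OF refl])
    fix s assume "s \<in> {..k}"
    then have "real (k - s) = real k - real s" by simp
    then have "t powr (\<beta> + 1) * t ^ (k - s) = t powr (\<beta> + 1 + real k - real s)"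
      "(1 - t) powr (\<alpha> + 1) * (1 - t) ^ s = (1 - t) powr (\<alpha> + 1 + real s)"
      using t powr_mult_power[of t "\<beta> + 1" "k - s"] powr_mult_power[of "1 - t" "\<alpha> + 1" s]
      by (simp_all add: add_diff_eq)
    note eqs = this
    show "(1 - t) powr (\<alpha> + 1) * t powr (\<beta> + 1) *
        ((real k + (\<alpha> + 1) gchoose (k - s)) * (real k + (\<beta> + 1) gchoose s) *
         (t - 1) ^ s * t ^ (k - s)) = A s * S s t"
      unfolding A_def S_def pm eqs[symmetric] by (simp only: mult_ac)
  qed
  have eqT: "(1 - y) powr \<alpha> * y powr \<beta> * poly (jacobi_poly (Suc k) \<alpha> \<beta>) (2 * y - 1)
      = (\<Sum>s\<le>Suc k. B s * T s y)"
    unfolding poly_jacobi_poly_unit sum_distrib_left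
  proof (rule sum.cong[OF refl])
    fix s assume "s \<in> {..Suc k}"
    then have "real (Suc k - s) = real (Suc k) - real s" by (simp add: of_nat_diff)
    then have "y powr \<beta> * y ^ (Suc k - s) = y powr (\<beta> + real (Suc k) - real s)"
      "(1 - y) powr \<alpha> * (1 - y) ^ s = (1 - y) powr (\<alpha> + real s)"
      using y powr_mult_power[of y \<beta> "Suc k - s"] powr_mult_power[of "1 - y" \<alpha> s]
      by (simp_all add: add_diff_eq)
    note eqs = this
    show "(1 - y) powr \<alpha> * y powr \<beta> *
        ((real (Suc k) + \<alpha> gchoose (Suc k - s)) * (real (Suc k) + \<beta> gchoose s) *
         (y - 1) ^ s * y ^ (Suc k - s)) = B s * T s y"
      unfolding B_def T_def pm eqs[symmetric] by (simp only: mult_ac)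
  qed
  \<comment> \<open>The second minus sign appears because \<open>T (Suc s)\<close> carries one more
    factor \<open>- 1\<close> than \<open>S s\<close>.\<close>
  have dS: "(S s has_real_derivative
      - (\<alpha> + 1 + real s) * T s y - (\<beta> + 1 + real k - real s) * T (Suc s) y) (at y)" for s
    unfolding S_def T_def using y
    by (auto intro!: derivative_eq_intros simp: algebra_simps)
  have absorb: "(a - real m) * (a gchoose m) = real (Suc m) * (a gchoose Suc m)" for a :: real and m
    using gbinomial_mult_1[of a m] by (simp add: left_diff_distrib)
  have A1: "(\<alpha> + 1 + real s) * A s = (real (Suc k) - real s) * B s" if "s \<le> k" for s
  proof -
    have "Suc k - s = Suc (k - s)" "real (k - s) = real k - real s"
      "real (Suc (k - s)) = real (Suc k) - real s" using that by auto
    then have "(\<alpha> + 1 + real s) * (real k + (\<alpha> + 1) gchoose (k - s)) =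
        (real (Suc k) - real s) * (real (Suc k) + \<alpha> gchoose (Suc k - s))"
      using absorb[of "real k + (\<alpha> + 1)" "k - s"] by (simp add: add_ac)
    then show ?thesis unfolding A_def B_def by (simp add: add_ac)
  qed
  have A2: "(\<beta> + 1 + real k - real s) * A s = real (Suc s) * B (Suc s)" if "s \<le> k" for s
  proof -
    have "(\<beta> + 1 + real k - real s) * (real k + (\<beta> + 1) gchoose s) =
        real (Suc s) * (real (Suc k) + \<beta> gchoose Suc s)"
      using absorb[of "real k + (\<beta> + 1)" s] by (simp add: add_ac)
    then show ?thesis unfolding A_def B_def by (simp add: add_ac)
  qed
  have "(\<Sum>s\<le>k. A s * (- (\<alpha> + 1 + real s) * T s y - (\<beta> + 1 + real k - real s) * T (Suc s) y))
      = (\<Sum>s\<le>k. - ((real (Suc k) - real s) * B s * T s y) - real (Suc s) * B (Suc s) * T (Suc s) y)"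
  proof (rule sum.cong[OF refl])
    fix s assume "s \<in> {..k}"
    have "A s * (- (\<alpha> + 1 + real s) * T s y - (\<beta> + 1 + real k - real s) * T (Suc s) y) =
        - ((\<alpha> + 1 + real s) * A s * T s y) - (\<beta> + 1 + real k - real s) * A s * T (Suc s) y"
      by (simp only: right_diff_distrib mult_minus_left mult_minus_right mult_ac)
    then show "A s * (- (\<alpha> + 1 + real s) * T s y - (\<beta> + 1 + real k - real s) * T (Suc s) y) =
        - ((real (Suc k) - real s) * B s * T s y) - real (Suc s) * B (Suc s) * T (Suc s) y"
      using \<open>s \<in> {..k}\<close> by (simp only: A1 A2 atMost_iff)
  qed
  also have "\<dots> = - (\<Sum>s\<le>k. (real (Suc k) - real s) * B s * T s y)
      - (\<Sum>s\<le>k. real (Suc s) * B (Suc s) * T (Suc s) y)"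
    by (simp add: sum_subtractf sum_negf)
  \<comment> \<open>The term added at \<open>s = Suc k\<close> has the factor \<open>0\<close>, and
    so has the term at \<open>s = 0\<close> added by the index shift that follows. The factors
    \<open>Suc k - s\<close> and \<open>s\<close> then add up to \<open>k + 1\<close>.\<close>
  also have "(\<Sum>s\<le>k. (real (Suc k) - real s) * B s * T s y)
      = (\<Sum>s\<le>Suc k. (real (Suc k) - real s) * B s * T s y)" by simp
  also have "(\<Sum>s\<le>k. real (Suc s) * B (Suc s) * T (Suc s) y) = (\<Sum>s\<le>Suc k. real s * B s * T s y)"
    by (subst sum.atMost_Suc_shift) simp
  also have "- (\<Sum>s\<le>Suc k. (real (Suc k) - real s) * B s * T s y) - (\<Sum>s\<le>Suc k. real s * B s * T s y)
      = - (real k + 1) * (\<Sum>s\<le>Suc k. B s * T s y)"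
    unfolding sum_negf[symmetric] sum_subtractf[symmetric] sum_distrib_left
    by (rule sum.cong[OF refl]) (simp add: algebra_simps)
  finally have eq: "(\<Sum>s\<le>k. A s * (- (\<alpha> + 1 + real s) * T s y - (\<beta> + 1 + real k - real s) * T (Suc s) y))
      = - (real k + 1) * (\<Sum>s\<le>Suc k. B s * T s y)" .
  have "((\<lambda>y. \<Sum>s\<le>k. A s * S s y) has_real_derivative
      (\<Sum>s\<le>k. A s * (- (\<alpha> + 1 + real s) * T s y - (\<beta> + 1 + real k - real s) * T (Suc s) y))) (at y)"
    by (intro DERIV_sum DERIV_cmult dS)
  then show ?thesis
    unfolding eq eqT[symmetric] mult.assoc[of "- (real k + 1)"]
    by (rule has_field_derivative_transform_within_open[of _ _ _ "{0<..<1}"]) (use y eqS in auto)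
qed

text \<open>The step uses the zeros for parameters raised by one, so \<alpha> and \<beta> vary in
  the induction. The weight adds the zeros \<open>0\<close> and \<open>1\<close> to the
  \<open>k\<close> given ones; Rolle then produces \<open>k + 1\<close> zeros of the derivative,
  which is a nonvanishing weight times the next Jacobi polynomial inside the interval.\<close>

lemma jacobi_poly_unit_zeros:
  assumes "\<alpha> > -1" "\<beta> > -1"
  shows "\<exists>Z. finite Z \<and> card Z = n \<and> Z \<subseteq> {0<..<1} \<and>
     (\<forall>y\<in>Z. poly (jacobi_poly n \<alpha> \<beta>) (2 * y - 1) = 0)"
  using assms
proof (induction n arbitrary: \<alpha> \<beta>)
  case 0
  then show ?case by (intro exI[of _ "{}"]) auto
next
  case (Suc k)
  obtain Z where Z: "finite Z" "card Z = k" "Z \<subseteq> {0<..<1}"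
    "\<forall>y\<in>Z. poly (jacobi_poly k (\<alpha> + 1) (\<beta> + 1)) (2 * y - 1) = 0"
    using Suc.IH[of "\<alpha> + 1" "\<beta> + 1"] Suc.prems by auto
  define g where "g y = (1 - y) powr (\<alpha> + 1) * y powr (\<beta> + 1) *
      poly (jacobi_poly k (\<alpha> + 1) (\<beta> + 1)) (2 * y - 1)" for y
  define g' where "g' y = - (real k + 1) * ((1 - y) powr \<alpha> * y powr \<beta>) *
      poly (jacobi_poly (Suc k) \<alpha> \<beta>) (2 * y - 1)" for y
  have "\<exists>W. finite W \<and> card W = Suc k \<and>
      W \<subseteq> {Min (insert 0 (insert 1 Z))<..<Max (insert 0 (insert 1 Z))} \<and> (\<forall>w\<in>W. g' w = 0)"
  proof (rule Rolle_card[where f = g and lo = 0 and hi = 1])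
    show "finite (insert 0 (insert 1 Z))" using Z by simp
    show "card (insert 0 (insert 1 Z)) = Suc (Suc k)" using Z by (subst card_insert_disjoint; force)+
    show "insert 0 (insert 1 Z) \<subseteq> {0..1}" using Z(3) by force
    show "g y = 0" if "y \<in> insert 0 (insert 1 Z)" for y using that Z(4) by (auto simp: g_def)
    \<comment> \<open>Since \<alpha> and \<beta> exceed -1, both exponents are positive and the
      weight is continuous up to the endpoints.\<close>
    show "continuous_on {0..1} g"
    proof -
      have "continuous_on {0..1} (\<lambda>y. (1 - y) powr (\<alpha> + 1))"
        by (rule continuous_on_powr') (use Suc.prems in \<open>auto intro!: continuous_intros\<close>)
      moreover have "continuous_on {0..1} (\<lambda>y. y powr (\<beta> + 1))"
        by (rule continuous_on_powr') (use Suc.prems in \<open>auto intro!: continuous_intros\<close>)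
      moreover have "continuous_on {0..1} (\<lambda>y. poly (jacobi_poly k (\<alpha> + 1) (\<beta> + 1)) (2 * y - 1))"
        by (intro continuous_intros)
      ultimately show ?thesis unfolding g_def by (intro continuous_on_mult)
    qed
    show "(g has_real_derivative g' y) (at y)" if "0 < y" "y < 1" for y
      unfolding g_def g'_def by (rule has_real_derivative_weighted_jacobi[OF that])
  qed
  then obtain W where W: "finite W" "card W = Suc k"
    "W \<subseteq> {Min (insert 0 (insert 1 Z))<..<Max (insert 0 (insert 1 Z))}" "\<forall>w\<in>W. g' w = 0" by blast
  have "Min (insert 0 (insert 1 Z)) = 0" using Z by (intro Min_eqI) force+
  moreover have "Max (insert 0 (insert 1 Z)) = 1" using Z by (intro Max_eqI) force+
  ultimately have W01: "W \<subseteq> {0<..<1}" using W(3) by simp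
  moreover have "poly (jacobi_poly (Suc k) \<alpha> \<beta>) (2 * w - 1) = 0" if "w \<in> W" for w
  proof -
    have "0 < w" "w < 1" "g' w = 0" using that W01 W(4) by auto
    then show ?thesis by (simp add: g'_def)
  qed
  ultimately show ?case using W by blast
qed

section \<open>Power expansion of Jacobi polynomials at the left endpoint\<close>

definition jacobi_coeff :: "nat \<Rightarrow> real \<Rightarrow> real \<Rightarrow> nat \<Rightarrow> real" where
  "jacobi_coeff n \<alpha> \<beta> j =
     (- 1) ^ (n - j) * ((real n + \<beta>) gchoose (n - j)) * ((real n + real j + \<alpha> + \<beta>) gchoose j)"

text \<open>The point \<open>y = 0\<close> is where the fractional operators start. Expanding
  \<open>(y - 1) ^ s\<close> and collecting \<open>y ^ (n - i)\<close> leaves a sum over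
  \<open>s\<close>, which trinomial revision and the Vandermonde convolution evaluate.\<close>

lemma poly_jacobi_poly_expansion:
  "poly (jacobi_poly n \<alpha> \<beta>) (2 * y - 1) = (\<Sum>j\<le>n. jacobi_coeff n \<alpha> \<beta> j * y ^ j)"
proof -
  define G where "G s = ((real n + \<alpha>) gchoose (n - s)) * ((real n + \<beta>) gchoose s)" for s
  have "poly (jacobi_poly n \<alpha> \<beta>) (2 * y - 1) = (\<Sum>s\<le>n. \<Sum>i\<le>s. G s * real (s choose i) * (- 1) ^ i * y ^ (n - i))"
    unfolding poly_jacobi_poly_unit
  proof (rule sum.cong[OF refl])
    fix s assume s: "s \<in> {..n}"
    have "(y - 1) ^ s * y ^ (n - s) = (\<Sum>i\<le>s. real (s choose i) * (- 1) ^ i * y ^ (s - i)) * y ^ (n - s)"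
      using binomial_ring[of "-1" y s] by simp
    also have "\<dots> = (\<Sum>i\<le>s. real (s choose i) * (- 1) ^ i * y ^ (n - i))"
      unfolding sum_distrib_right using s
      by (intro sum.cong) (simp_all add: mult.assoc power_add[symmetric])
    finally show "(real n + \<alpha> gchoose (n - s)) * (real n + \<beta> gchoose s) * (y - 1) ^ s * y ^ (n - s)
        = (\<Sum>i\<le>s. G s * real (s choose i) * (- 1) ^ i * y ^ (n - i))"
      unfolding G_def by (simp add: sum_distrib_left mult.assoc)
  qed
  also have "\<dots> = (\<Sum>i\<le>n. \<Sum>s=i..n. G s * real (s choose i) * (- 1) ^ i * y ^ (n - i))"
    unfolding sum.Sigma[OF finite_atMost ballI[OF finite_atMost]]
      sum.Sigma[OF finite_atMost ballI[OF finite_atLeastAtMost]]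
    by (intro sum.reindex_bij_witness[of _ "\<lambda>(i, s). (s, i)" "\<lambda>(s, i). (i, s)"]) auto
  also have "\<dots> = (\<Sum>i\<le>n. jacobi_coeff n \<alpha> \<beta> (n - i) * y ^ (n - i))"
  proof (rule sum.cong[OF refl])
    fix i assume i: "i \<in> {..n}"
    have "(\<Sum>s=i..n. G s * real (s choose i))
        = (\<Sum>s=i..n. ((real n + \<beta>) gchoose i) *
            (((real n + \<beta> - real i) gchoose (s - i)) * ((real n + \<alpha>) gchoose (n - s))))"
      using gbinomial_trinomial_revision[of i _ "real n + \<beta>"] unfolding G_def
      by (intro sum.cong) (auto simp: binomial_gbinomial algebra_simps)
    \<comment> \<open>With \<open>r = s - i\<close> this is a Vandermonde sum; its upper arguments
      add up to \<open>n + (n - i) + \<alpha> + \<beta>\<close>, which is the shape of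
      \<open>jacobi_coeff\<close> at \<open>j = n - i\<close>.\<close>
    also have "\<dots> = ((real n + \<beta>) gchoose i) * (\<Sum>r=0..n - i. ((real n + \<beta> - real i) gchoose r) *
        ((real n + \<alpha>) gchoose (n - i - r)))"
      unfolding sum_distrib_left using i
      by (intro sum.reindex_bij_witness[of _ "\<lambda>r. r + i" "\<lambda>s. s - i"]) auto
    also have "\<dots> = ((real n + \<beta>) gchoose i) * ((real n + real (n - i) + \<alpha> + \<beta>) gchoose (n - i))"
      using i unfolding gbinomial_Vandermonde by (simp add: of_nat_diff algebra_simps)
    finally have "(\<Sum>s=i..n. G s * real (s choose i)) * (- 1) ^ i = jacobi_coeff n \<alpha> \<beta> (n - i)"
      using i by (simp add: jacobi_coeff_def)
    then show "(\<Sum>s=i..n. G s * real (s choose i) * (- 1) ^ i * y ^ (n - i))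
        = jacobi_coeff n \<alpha> \<beta> (n - i) * y ^ (n - i)"
      by (simp add: sum_distrib_right[symmetric])
  qed
  also have "\<dots> = (\<Sum>j\<le>n. jacobi_coeff n \<alpha> \<beta> j * y ^ j)"
    by (rule sum.nat_diff_reindex[where n = "Suc n", unfolded lessThan_Suc_atMost, simplified])
  finally show ?thesis .
qed

text \<open>The binomial is a rising factorial from \<open>n + \<alpha> + \<beta> + 1\<close>, over
  a factorial. For positive \<open>n\<close> that start is positive; for \<open>n = 0\<close> it may
  be negative, but the product is empty.\<close>

lemma jacobi_coeff_top_pos:
  assumes "\<alpha> > -1" "\<beta> > -1"
  shows "jacobi_coeff n \<alpha> \<beta> n > 0"
proof (cases n)
  case (Suc m)
  then show ?thesis using assms
    by (auto simp: jacobi_coeff_def gbinomial_pochhammer' intro!: divide_pos_pos pochhammer_pos)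
qed (simp add: jacobi_coeff_def)

text \<open>The sum of the two parameters is unchanged, so the second binomial stays the same. The
  first one is a Gamma quotient whose \<open>j\<close>-dependent part is exchanged by the multiplier
  on the left, leaving a factor in \<open>n\<close> alone.\<close>

lemma jacobi_coeff_shift:
  assumes "j \<le> n" "\<beta> > -1" "\<beta> - \<mu> > -1"
  shows "jacobi_coeff n \<alpha> \<beta> j * (Gamma (real j + \<beta> + 1) / Gamma (real j + \<beta> - \<mu> + 1)) =
    Gamma (real n + \<beta> + 1) / Gamma (real n + \<beta> - \<mu> + 1) * jacobi_coeff n (\<alpha> + \<mu>) (\<beta> - \<mu>) j"
proof -
  have G: "((real n + c) gchoose (n - j)) = Gamma (real n + c + 1) / (fact (n - j) * Gamma (real j + c + 1))"
    if "c > -1" for c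
  proof -
    have "real n + c + 1 \<notin> \<int>\<^sub>\<le>\<^sub>0" using that by (auto elim!: nonpos_Ints_cases)
    then show ?thesis using assms(1) by (simp add: gbinomial_Gamma of_nat_diff algebra_simps)
  qed
  have "Gamma (real n + \<beta> - \<mu> + 1) > 0" "Gamma (real j + \<beta> + 1) > 0" "Gamma (real j + \<beta> - \<mu> + 1) > 0"
    using assms by (auto intro!: Gamma_real_pos)
  then show ?thesis
    unfolding jacobi_coeff_def G[OF assms(2)] G[OF assms(3)]
    by (simp add: field_simps)
qed

section \<open>Erdelyi-Kober operators on powers\<close>

text \<open>The substitution \<open>u = (t / y) powr \<sigma>\<close> maps the open interval from
  \<open>0\<close> to \<open>y\<close> onto the unit interval and turns the kernel into a Beta
  integrand.\<close>

lemma power_kernel_integral: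
  fixes \<sigma> \<nu> a y :: real
  assumes "\<sigma> > 0" "\<nu> > 0" "a > 0" "y > 0"
  shows "set_integrable lborel {0..y} (\<lambda>t. (y powr \<sigma> - t powr \<sigma>) powr (\<nu> - 1) * t powr (\<sigma> * a - 1))"
    and "(LBINT t:{0..y}. (y powr \<sigma> - t powr \<sigma>) powr (\<nu> - 1) * t powr (\<sigma> * a - 1)) =
      y powr (\<sigma> * (a + \<nu> - 1)) / \<sigma> * Beta a \<nu>"
proof -
  define h where "h t = (y powr \<sigma> - t powr \<sigma>) powr (\<nu> - 1) * t powr (\<sigma> * a - 1)" for t
  define f where "f u = u powr (a - 1) * (1 - u) powr (\<nu> - 1)" for u :: real
  define g where "g t = (t / y) powr \<sigma>" for t
  define g' where "g' t = \<sigma> * t powr (\<sigma> - 1) / y powr \<sigma>" for t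
  \<comment> \<open>\<open>C\<close> collects the powers of \<open>y\<close> and the factor
    \<open>1 / \<sigma>\<close> left over by the substitution.\<close>
  define C where "C = y powr (\<sigma> * (a + \<nu> - 1)) / \<sigma>"
  have f_int: "(f has_integral Beta a \<nu>) {0<..<1}"
    using has_integral_Beta_real[OF assms(3,2)] unfolding f_def has_integral_Icc_iff_Ioo .
  have f_abs: "f absolutely_integrable_on {0<..<1}"
    using f_int by (intro nonnegative_absolutely_integrable_1) (auto simp: f_def has_integral_integrable)
  have g_img: "g ` {0<..<y} = {0<..<1}"
  proof -
    have "u \<in> g ` {0<..<y}" if u: "0 < u" "u < 1" for u
    proof
      show "u = g (y * u powr (1 / \<sigma>))" using assms u by (simp add: g_def powr_powr)
      show "y * u powr (1 / \<sigma>) \<in> {0<..<y}"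
        using assms u powr_less_mono2[of "1 / \<sigma>" u 1] by auto
    qed
    moreover have "g t \<in> {0<..<1}" if "0 < t" "t < y" for t
      using that assms powr_less_mono2[of \<sigma> "t / y" 1] by (auto simp: g_def)
    ultimately show ?thesis by auto
  qed
  have "inj_on g {0<..<y}"
    using assms
    by (intro inj_on_inverseI[of _ "\<lambda>u. y * u powr (1 / \<sigma>)"]) (simp add: g_def powr_powr)
  moreover have "(g has_field_derivative g' t) (at t within {0<..<y})" if "t \<in> {0<..<y}" for t
    unfolding g_def g'_def using that assms
    by (auto intro!: derivative_eq_intros simp: powr_divide powr_diff field_simps)
  ultimately have "(\<lambda>t. \<bar>g' t\<bar> * f (g t)) absolutely_integrable_on {0<..<y} \<and>
      integral {0<..<y} (\<lambda>t. \<bar>g' t\<bar> * f (g t)) = Beta a \<nu>"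
    using has_absolute_integral_change_of_variables_1'[of "{0<..<y}" g g' f "Beta a \<nu>"]
      g_img f_abs f_int by (auto simp: integral_unique)
  then have sub: "(\<lambda>t. C * (\<bar>g' t\<bar> * f (g t))) absolutely_integrable_on {0<..<y}"
    "integral {0<..<y} (\<lambda>t. C * (\<bar>g' t\<bar> * f (g t))) = C * Beta a \<nu>"
    by (auto intro: set_integrable_mult_right)
  have eq: "C * (\<bar>g' t\<bar> * f (g t)) = h t" if t: "t \<in> {0<..<y}" for t
  proof -
    have "t powr \<sigma> < y powr \<sigma>" using t assms by (intro powr_less_mono2) auto
    moreover have "1 - (t / y) powr \<sigma> = (y powr \<sigma> - t powr \<sigma>) / y powr \<sigma>"
      using t assms by (simp add: powr_divide field_simps)
    ultimately have "f (g t) = t powr (\<sigma> * (a - 1)) / y powr (\<sigma> * (a - 1)) *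
        ((y powr \<sigma> - t powr \<sigma>) powr (\<nu> - 1) / y powr (\<sigma> * (\<nu> - 1)))"
      using t assms by (simp add: f_def g_def powr_divide powr_powr)
    moreover have "\<bar>g' t\<bar> = \<sigma> * t powr (\<sigma> - 1) / y powr \<sigma>" using assms by (simp add: g'_def)
    moreover have "t powr (\<sigma> * a - 1) = t powr (\<sigma> - 1) * t powr (\<sigma> * (a - 1))"
      by (simp add: powr_add[symmetric] algebra_simps)
    moreover have "y powr (\<sigma> * (a + \<nu> - 1)) = y powr \<sigma> * y powr (\<sigma> * (a - 1)) * y powr (\<sigma> * (\<nu> - 1))"
      by (simp add: powr_add[symmetric] algebra_simps)
    ultimately show ?thesis using assms by (simp add: h_def C_def)
  qed
  have h_abs: "h absolutely_integrable_on {0<..<y}"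
    by (rule iffD1[OF set_integrable_cong[OF refl refl eq] sub(1)])
  have h_int: "integral {0<..<y} h = C * Beta a \<nu>"
    unfolding sub(2)[symmetric] by (rule Henstock_Kurzweil_Integration.integral_cong) (rule eq[symmetric])
  \<comment> \<open>The change of variables yields integrability for the completed measure; Borel
    measurability carries it over to \<open>lborel\<close>, over which \<open>LBINT\<close>
    integrates.\<close>
  have meas: "(\<lambda>t. indicat_real {0..y} t *\<^sub>R h t) \<in> borel_measurable lborel"
    unfolding h_def by measurable
  have "h integrable_on {0<..<y}"
    using h_abs set_lebesgue_integral_eq_integral(1) by blast
  then have "(h has_integral C * Beta a \<nu>) {0..y}"
    using h_int unfolding has_integral_Icc_iff_Ioo by (metis integrable_integral)
  then have "h absolutely_integrable_on {0..y}"
    by (intro nonnegative_absolutely_integrable_1) (auto simp: h_def has_integral_integrable)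
  then show int: "set_integrable lborel {0..y} h"
    using integrable_completion[OF meas] by (simp add: set_integrable_def)
  show "(LBINT t:{0..y}. h t) = C * Beta a \<nu>"
    using set_borel_integral_eq_integral(2)[OF int] \<open>(h has_integral C * Beta a \<nu>) {0..y}\<close>
    by (simp add: integral_unique)
qed

text \<open>Each power contributes a kernel integral with \<open>a = d p + \<eta> + 1\<close>, and
  the factor \<open>Gamma \<nu>\<close> of the Beta value cancels the normalization.\<close>

lemma EK_integral_powr_sum:
  fixes d \<gamma> :: "'i \<Rightarrow> real"
  assumes "\<sigma> > 0" "\<nu> \<ge> 0" "y > 0" "finite A"
    and f: "\<And>t. t > 0 \<Longrightarrow> f t = (\<Sum>p\<in>A. \<gamma> p * t powr (\<sigma> * d p))"
    and d: "\<And>p. p \<in> A \<Longrightarrow> d p + \<eta> + 1 > 0"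
  shows "EK_integral \<sigma> \<eta> \<nu> f y =
    (\<Sum>p\<in>A. \<gamma> p * (Gamma (d p + \<eta> + 1) / Gamma (d p + \<eta> + \<nu> + 1)) * y powr (\<sigma> * d p))"
proof (cases "\<nu> = 0")
  case True
  \<comment> \<open>For \<open>\<nu> = 0\<close> the two Gamma values coincide, and their quotient
    is \<open>1\<close> because they are nonzero. This case serves integer orders \<mu>.\<close>
  have "Gamma (d p + \<eta> + 1) \<noteq> 0" if "p \<in> A" for p
    using Gamma_real_pos[OF d[OF that]] by simp
  then show ?thesis using True f assms(3) by (simp add: EK_integral_def)
next
  case False
  then have \<nu>: "\<nu> > 0" using assms(2) by simp
  define K where "K p t = (y powr \<sigma> - t powr \<sigma>) powr (\<nu> - 1) * t powr (\<sigma> * (d p + \<eta> + 1) - 1)" for p t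
  have K_int: "set_integrable lborel {0..y} (K p)"
    and K_val: "(LBINT t:{0..y}. K p t) = y powr (\<sigma> * (d p + \<eta> + \<nu>)) / \<sigma> * Beta (d p + \<eta> + 1) \<nu>"
    if "p \<in> A" for p
    using power_kernel_integral[OF assms(1) \<nu> d[OF that] assms(3)]
    unfolding K_def by (simp_all add: algebra_simps)
  \<comment> \<open>At \<open>t = 0\<close>, where \<open>f\<close> is unconstrained, both sides vanish because \<open>0 powr a = 0\<close>.\<close>
  have "(y powr \<sigma> - t powr \<sigma>) powr (\<nu> - 1) * t powr (\<sigma> * (\<eta> + 1) - 1) * f t = (\<Sum>p\<in>A. \<gamma> p * K p t)"
    if "t \<in> {0..y}" for t
  proof (cases "t = 0")
    case True
    then show ?thesis by (simp add: K_def)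
  next
    case False
    have "t powr (\<sigma> * (d p + \<eta> + 1) - 1) = t powr (\<sigma> * (\<eta> + 1) - 1) * t powr (\<sigma> * d p)" for p
      by (simp add: powr_add[symmetric] algebra_simps)
    then show ?thesis
      using False that by (simp add: f K_def sum_distrib_left mult_ac)
  qed
  then have "(LBINT t:{0..y}. (y powr \<sigma> - t powr \<sigma>) powr (\<nu> - 1) * t powr (\<sigma> * (\<eta> + 1) - 1) * f t)
      = (LBINT t:{0..y}. (\<Sum>p\<in>A. \<gamma> p * K p t))"
    by (intro set_lebesgue_integral_cong) auto
  also have "\<dots> = (\<Sum>p\<in>A. (LBINT t:{0..y}. \<gamma> p * K p t))"
    using K_int unfolding set_lebesgue_integral_def set_integrable_def scaleR_sum_right
    by (subst Bochner_Integration.integral_sum) (auto simp: mult.left_commute)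
  also have "\<dots> = (\<Sum>p\<in>A. \<gamma> p * (y powr (\<sigma> * (d p + \<eta> + \<nu>)) / \<sigma> * Beta (d p + \<eta> + 1) \<nu>))"
    by (intro sum.cong) (simp_all add: K_val)
  finally have *: "EK_integral \<sigma> \<eta> \<nu> f y = \<sigma> * y powr (- \<sigma> * (\<eta> + \<nu>)) / Gamma \<nu> *
      (\<Sum>p\<in>A. \<gamma> p * (y powr (\<sigma> * (d p + \<eta> + \<nu>)) / \<sigma> * Beta (d p + \<eta> + 1) \<nu>))"
    using False by (simp add: EK_integral_def)
  show ?thesis unfolding * sum_distrib_left
  proof (rule sum.cong[OF refl])
    fix p assume "p \<in> A"
    have "y powr (\<sigma> * d p) = y powr (- \<sigma> * (\<eta> + \<nu>)) * y powr (\<sigma> * (d p + \<eta> + \<nu>))"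
      by (simp add: powr_add[symmetric] algebra_simps)
    moreover have "Gamma \<nu> > 0" using \<nu> by simp
    moreover have "Beta (d p + \<eta> + 1) \<nu> = Gamma (d p + \<eta> + 1) * Gamma \<nu> / Gamma (d p + \<eta> + \<nu> + 1)"
      by (simp add: Beta_def algebra_simps)
    ultimately show "\<sigma> * y powr (- \<sigma> * (\<eta> + \<nu>)) / Gamma \<nu> *
        (\<gamma> p * (y powr (\<sigma> * (d p + \<eta> + \<nu>)) / \<sigma> * Beta (d p + \<eta> + 1) \<nu>)) =
        \<gamma> p * (Gamma (d p + \<eta> + 1) / Gamma (d p + \<eta> + \<nu> + 1)) * y powr (\<sigma> * d p)"
      using assms(1) by simp
  qed
qed

text \<open>In the variable \<open>y powr \<sigma>\<close> the operator is ordinary differentiation.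
  Writing the exponents as \<open>e p + real n\<close> keeps \<open>e\<close> fixed while each step
  lowers \<open>n\<close>.\<close>

lemma funpow_scaled_deriv_powr_sum:
  fixes e \<gamma> :: "'i \<Rightarrow> real"
  assumes "\<sigma> > 0" "finite A" "x > 0"
    and "\<And>y. y > 0 \<Longrightarrow> g y = (\<Sum>p\<in>A. \<gamma> p * y powr (\<sigma> * (e p + real n)))"
  shows "((\<lambda>g y. 1 / (\<sigma> * y powr (\<sigma> - 1)) * deriv g y) ^^ n) g x =
    (\<Sum>p\<in>A. \<gamma> p * pochhammer (e p + 1) n * x powr (\<sigma> * e p))"
  using assms(3,4)
proof (induction n arbitrary: g \<gamma>)
  case 0
  then show ?case by simp
next
  case (Suc n)
  let ?L = "\<lambda>g y. 1 / (\<sigma> * y powr (\<sigma> - 1)) * deriv g y"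
  have "?L g y = (\<Sum>p\<in>A. \<gamma> p * (e p + real (Suc n)) * y powr (\<sigma> * (e p + real n)))" if y: "y > 0" for y
  proof -
    have "((\<lambda>y. \<Sum>p\<in>A. \<gamma> p * y powr (\<sigma> * (e p + real (Suc n)))) has_real_derivative
        (\<Sum>p\<in>A. \<gamma> p * (\<sigma> * (e p + real (Suc n)) * y powr (\<sigma> * (e p + real (Suc n)) - 1)))) (at y)"
      using y by (intro DERIV_sum DERIV_cmult has_real_derivative_powr)
    then have "(g has_real_derivative
        (\<Sum>p\<in>A. \<gamma> p * (\<sigma> * (e p + real (Suc n)) * y powr (\<sigma> * (e p + real (Suc n)) - 1)))) (at y)"
      \<comment> \<open>The formula for \<open>g\<close> is known only for positive arguments; this
        suffices, as the derivative is local.\<close>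
      by (rule has_field_derivative_transform_within_open[of _ _ _ "{0<..}"]) (use y Suc.prems(2) in auto)
    then have "?L g y = 1 / (\<sigma> * y powr (\<sigma> - 1)) *
        (\<Sum>p\<in>A. \<gamma> p * (\<sigma> * (e p + real (Suc n)) * y powr (\<sigma> * (e p + real (Suc n)) - 1)))"
      by (simp only: DERIV_imp_deriv)
    also have "\<dots> = (\<Sum>p\<in>A. \<gamma> p * (e p + real (Suc n)) * y powr (\<sigma> * (e p + real n)))"
      unfolding sum_distrib_left
    proof (rule sum.cong[OF refl])
      fix p
      have "y powr (\<sigma> * (e p + real (Suc n)) - 1) = y powr (\<sigma> - 1) * y powr (\<sigma> * (e p + real n))"
        by (simp add: powr_add[symmetric] algebra_simps)
      then show "1 / (\<sigma> * y powr (\<sigma> - 1)) *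
          (\<gamma> p * (\<sigma> * (e p + real (Suc n)) * y powr (\<sigma> * (e p + real (Suc n)) - 1))) =
          \<gamma> p * (e p + real (Suc n)) * y powr (\<sigma> * (e p + real n))"
        using y assms(1) by simp
    qed
    finally show ?thesis .
  qed
  \<comment> \<open>The innermost application is peeled off, so the induction hypothesis is used for
    \<open>?L g\<close> with coefficients multiplied by \<open>e p + real (Suc n)\<close>.\<close>
  then have "(?L ^^ n) (?L g) x =
      (\<Sum>p\<in>A. \<gamma> p * (e p + real (Suc n)) * pochhammer (e p + 1) n * x powr (\<sigma> * e p))"
    using Suc.prems(1) by (intro Suc.IH)
  then show ?case
    by (simp add: funpow_Suc_right pochhammer_Suc algebra_simps del: funpow.simps)
qed

text \<open>The integral of order \<open>n - \<mu>\<close> puts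
  \<open>Gamma (d p + \<eta> + 1 + real n)\<close> into the denominator; the \<open>n\<close>
  derivatives contribute a rising factorial, that is, the same value over
  \<open>Gamma (d p + \<eta> + 1)\<close>, so \<open>n\<close> cancels.\<close>

lemma EK_derivative_powr_sum:
  fixes d \<gamma> :: "'i \<Rightarrow> real"
  assumes "\<sigma> > 0" "\<mu> > 0" "x > 0" "finite A"
    and f: "\<And>t. t > 0 \<Longrightarrow> f t = (\<Sum>p\<in>A. \<gamma> p * t powr (\<sigma> * d p))"
    and d: "\<And>p. p \<in> A \<Longrightarrow> d p + \<eta> + 1 > 0"
  shows "EK_derivative \<sigma> \<eta> \<mu> f x =
    (\<Sum>p\<in>A. \<gamma> p * (Gamma (d p + \<eta> + \<mu> + 1) / Gamma (d p + \<eta> + 1)) * x powr (\<sigma> * d p))"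
proof -
  define n where "n = nat \<lceil>\<mu>\<rceil>"
  have n: "real n \<ge> \<mu>" unfolding n_def by (simp add: real_nat_ceiling_ge)
  define c where "c p = \<gamma> p * (Gamma (d p + \<eta> + \<mu> + 1) / Gamma (d p + \<eta> + 1 + real n))" for p
  have EK: "y powr (\<sigma> * (\<eta> + real n)) * EK_integral \<sigma> (\<eta> + \<mu>) (real n - \<mu>) f y =
      (\<Sum>p\<in>A. c p * y powr (\<sigma> * ((d p + \<eta>) + real n)))" if "y > 0" for y
  proof -
    have "d p + (\<eta> + \<mu>) + 1 > 0" if "p \<in> A" for p
      using d[OF that] assms(2) by simp
    then have "EK_integral \<sigma> (\<eta> + \<mu>) (real n - \<mu>) f y = (\<Sum>p\<in>A. \<gamma> p *
        (Gamma (d p + (\<eta> + \<mu>) + 1) / Gamma (d p + (\<eta> + \<mu>) + (real n - \<mu>) + 1)) * y powr (\<sigma> * d p))"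
      using n by (intro EK_integral_powr_sum assms that) auto
    also have "\<dots> = (\<Sum>p\<in>A. c p * y powr (\<sigma> * d p))"
      by (simp add: c_def algebra_simps)
    finally show ?thesis
      by (simp add: sum_distrib_left powr_add[symmetric] algebra_simps)
  qed
  have "EK_derivative \<sigma> \<eta> \<mu> f x = x powr (- \<sigma> * \<eta>) *
      (\<Sum>p\<in>A. c p * pochhammer (d p + \<eta> + 1) n * x powr (\<sigma> * (d p + \<eta>)))"
    unfolding EK_derivative_def Let_def n_def[symmetric]
    using funpow_scaled_deriv_powr_sum[OF assms(1,4,3) EK] by simp
  also have "\<dots> = (\<Sum>p\<in>A. \<gamma> p * (Gamma (d p + \<eta> + \<mu> + 1) / Gamma (d p + \<eta> + 1)) * x powr (\<sigma> * d p))"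
    unfolding sum_distrib_left
  proof (rule sum.cong[OF refl])
    fix p assume p: "p \<in> A"
    have "Gamma (d p + \<eta> + 1 + real n) > 0" using d[OF p] by (intro Gamma_real_pos) simp
    moreover have "pochhammer (d p + \<eta> + 1) n = Gamma (d p + \<eta> + 1 + real n) / Gamma (d p + \<eta> + 1)"
      using d[OF p] by (intro pochhammer_Gamma) (auto elim!: nonpos_Ints_cases)
    moreover have "x powr (\<sigma> * d p) = x powr (- \<sigma> * \<eta>) * x powr (\<sigma> * (d p + \<eta>))"
      by (simp add: powr_add[symmetric] algebra_simps)
    ultimately show "x powr (- \<sigma> * \<eta>) * (c p * pochhammer (d p + \<eta> + 1) n * x powr (\<sigma> * (d p + \<eta>))) =
        \<gamma> p * (Gamma (d p + \<eta> + \<mu> + 1) / Gamma (d p + \<eta> + 1)) * x powr (\<sigma> * d p)"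
      by (simp add: c_def)
  qed
  finally show ?thesis .
qed

section \<open>Collocation\<close>

lemma lagrange_basis_node:
  fixes w :: "nat \<Rightarrow> real"
  assumes "inj_on w {0..N}" "i \<in> {0..N}" "k \<in> {0..N}"
  shows "(\<Prod>j\<in>{0..N} - {i}. (w k - w j) / (w i - w j)) = (if k = i then 1 else 0)"
proof (cases "k = i")
  case True
  then have "w i \<noteq> w j" if "j \<in> {0..N} - {i}" for j
    using assms that by (auto simp: inj_on_def)
  then show ?thesis using True by (auto intro!: prod.neutral)
next
  case False
  then show ?thesis using assms by (auto intro!: prod_zero)
qed

text \<open>Both sides are polynomials of degree at most \<open>N\<close> that agree at
  \<open>N + 1\<close> distinct points.\<close>

lemma lagrange_interpolation_exact:
  fixes w :: "nat \<Rightarrow> real"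
  assumes inj: "inj_on w {0..N}" and deg: "degree q \<le> N"
  shows "(\<Sum>i=0..N. poly q (w i) * (\<Prod>j\<in>{0..N} - {i}. (t - w j) / (w i - w j))) = poly q t"
proof -
  define L where "L = (\<Sum>i=0..N. Polynomial.smult (poly q (w i))
    (\<Prod>j\<in>{0..N} - {i}. Polynomial.smult (1 / (w i - w j)) [:- w j, 1:]))"
  have L: "poly L t = (\<Sum>i=0..N. poly q (w i) * (\<Prod>j\<in>{0..N} - {i}. (t - w j) / (w i - w j)))" for t
    by (simp add: L_def poly_sum poly_prod diff_divide_distrib)
  have "degree L \<le> N"
    unfolding L_def
  proof (rule degree_sum_le)
    fix i assume i: "i \<in> {0..N}"
    have "degree (\<Prod>j\<in>{0..N} - {i}. Polynomial.smult (1 / (w i - w j)) [:- w j, 1:]) \<le>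
        (\<Sum>j\<in>{0..N} - {i}. (degree \<circ> (\<lambda>j. Polynomial.smult (1 / (w i - w j)) [:- w j, 1:])) j)"
      by (rule degree_prod_sum_le) simp
    also have "\<dots> \<le> (\<Sum>j\<in>{0..N} - {i}. 1)"
      by (intro sum_mono) simp
    also have "\<dots> = N" using i by simp
    finally show "degree (Polynomial.smult (poly q (w i))
        (\<Prod>j\<in>{0..N} - {i}. Polynomial.smult (1 / (w i - w j)) [:- w j, 1:])) \<le> N"
      by (rule order_trans[OF degree_smult_le])
  qed simp
  have "L = q"
  proof (rule poly_eqI_degree[where A = "w ` {0..N}"])
    have "card (w ` {0..N}) = Suc N" using card_image[OF inj] by simp
    then show "degree L < card (w ` {0..N})" "degree q < card (w ` {0..N})"
      using \<open>degree L \<le> N\<close> deg by simp_all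
    show "poly L u = poly q u" if u: "u \<in> w ` {0..N}" for u
    proof -
      obtain k where k: "k \<in> {0..N}" "u = w k" using u by (rule imageE) (rule that)
      have "poly L u = (\<Sum>i=0..N. if k = i then poly q (w i) else 0)"
        unfolding L k(2)
      proof (rule sum.cong[OF refl])
        fix i assume "i \<in> {0..N}"
        from lagrange_basis_node[OF inj this k(1)]
        show "poly q (w i) * (\<Prod>j\<in>{0..N} - {i}. (w k - w j) / (w i - w j)) =
            (if k = i then poly q (w i) else 0)" by simp
      qed
      then show ?thesis using k by (simp only: sum.delta' finite_atLeastAtMost if_True)
    qed
  qed
  then show ?thesis using L[of t] by (simp only:)
qed

lemma graded_polys_independent:
  fixes p :: "nat \<Rightarrow> real poly"
  assumes "\<And>i. i \<le> N \<Longrightarrow> degree (p i) = i" "\<And>i. i \<le> N \<Longrightarrow> p i \<noteq> 0"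
    and "(\<Sum>i\<le>N. Polynomial.smult (v i) (p i)) = 0" "i \<le> N"
  shows "v i = 0"
  using assms
proof (induction N)
  case 0
  then show ?case by simp
next
  case (Suc N)
  \<comment> \<open>The polynomials of lower index have degree below \<open>Suc N\<close>, so this
    coefficient isolates the last term.\<close>
  have "coeff (\<Sum>i\<le>N. Polynomial.smult (v i) (p i)) (Suc N) = 0"
    using Suc.prems(1) by (auto simp: coeff_sum intro!: sum.neutral coeff_eq_0)
  then have "v (Suc N) * lead_coeff (p (Suc N)) = 0"
    using arg_cong[OF Suc.prems(3), of "\<lambda>q. coeff q (Suc N)"] Suc.prems(1) by simp
  then have *: "v (Suc N) = 0" using Suc.prems(2) by simp
  show ?case
  proof (cases "i = Suc N")
    case False
    then show ?thesis using Suc.IH Suc.prems * by simp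
  qed (use * in simp)
qed

section \<open>Jacobi polynomials in the unit variable and Jacobi-Muentz functions\<close>

definition shifted_jacobi :: "nat \<Rightarrow> real \<Rightarrow> real \<Rightarrow> real poly" where
  "shifted_jacobi n \<alpha> \<beta> = pcompose (jacobi_poly n \<alpha> \<beta>) [:-1, 2:]"

lemma poly_shifted_jacobi: "poly (shifted_jacobi n \<alpha> \<beta>) y = poly (jacobi_poly n \<alpha> \<beta>) (2 * y - 1)"
  by (simp add: shifted_jacobi_def poly_pcompose algebra_simps)

lemma shifted_jacobi_eq: "shifted_jacobi n \<alpha> \<beta> = (\<Sum>j\<le>n. monom (jacobi_coeff n \<alpha> \<beta> j) j)"
  by (rule poly_ext)
    (simp add: poly_shifted_jacobi poly_jacobi_poly_expansion poly_sum poly_monom)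

lemma coeff_shifted_jacobi_top: "coeff (shifted_jacobi n \<alpha> \<beta>) n = jacobi_coeff n \<alpha> \<beta> n"
  by (simp add: shifted_jacobi_eq coeff_sum)

text \<open>The lower bound comes from the positive top coefficient. Exact degrees make the family
  graded, hence linearly independent.\<close>

lemma degree_shifted_jacobi:
  assumes "\<alpha> > -1" "\<beta> > -1"
  shows "degree (shifted_jacobi n \<alpha> \<beta>) = n"
proof (rule antisym)
  show "degree (shifted_jacobi n \<alpha> \<beta>) \<le> n"
    unfolding shifted_jacobi_eq by (intro degree_sum_le) (auto intro: order_trans[OF degree_monom_le])
  show "n \<le> degree (shifted_jacobi n \<alpha> \<beta>)"
    using jacobi_coeff_top_pos[OF assms, of n] by (intro le_degree) (simp add: coeff_shifted_jacobi_top)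
qed

lemma shifted_jacobi_nonzero:
  assumes "\<alpha> > -1" "\<beta> > -1"
  shows "shifted_jacobi n \<alpha> \<beta> \<noteq> 0"
  using jacobi_coeff_top_pos[OF assms, of n] coeff_shifted_jacobi_top[of n \<alpha> \<beta>] by auto

lemma jacobi_muentz1_eq_powr_sum:
  assumes "b > 0" "t > 0"
  shows "jacobi_muentz1 b n \<alpha> \<beta> \<mu> \<sigma> \<eta> t =
    (\<Sum>j\<le>n. jacobi_coeff n \<alpha> \<beta> j * b powr (- \<sigma> * real j) * t powr (\<sigma> * (\<beta> - \<eta> - \<mu> + real j)))"
proof -
  have "((t / b) powr \<sigma>) ^ j = b powr (- \<sigma> * real j) * t powr (\<sigma> * real j)" for j
    using assms by (simp add: powr_power powr_divide powr_minus divide_simps mult.commute)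
  then show ?thesis
    unfolding jacobi_muentz1_def poly_jacobi_poly_expansion
    by (simp add: sum_distrib_left powr_add distrib_left mult_ac)
qed

text \<open>The exponents satisfy \<open>d p + \<eta> + \<mu> = \<beta> + j\<close>, so the
  multipliers are those of \<open>jacobi_coeff_shift\<close>. Replacing \<beta> and \<eta> by their
  values minus \<mu> leaves the prefactor exponent unchanged. Summing over pairs of function and
  power treats the whole combination at once.\<close>

lemma EK_derivative_jacobi_muentz1_sum:
  assumes "b > 0" "\<sigma> > 0" "\<beta> > -1" "\<mu> > 0" "\<beta> - \<mu> > -1" "x > 0" "finite I"
    and f: "\<And>t. t > 0 \<Longrightarrow> f t = (\<Sum>i\<in>I. c i * jacobi_muentz1 b i \<alpha> \<beta> \<mu> \<sigma> \<eta> t)"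
  shows "EK_derivative \<sigma> \<eta> \<mu> f x =
    (\<Sum>i\<in>I. c i * (Gamma (real i + \<beta> + 1) / Gamma (real i + \<beta> - \<mu> + 1) *
              jacobi_muentz1 b i (\<alpha> + \<mu>) (\<beta> - \<mu>) \<mu> \<sigma> (\<eta> - \<mu>) x))"
proof -
  define d where "d p = \<beta> - \<eta> - \<mu> + real (snd p)" for p :: "nat \<times> nat"
  define \<gamma> where "\<gamma> p = c (fst p) * (jacobi_coeff (fst p) \<alpha> \<beta> (snd p) * b powr (- \<sigma> * real (snd p)))"
    for p :: "nat \<times> nat"
  have sigma: "(\<Sum>p\<in>Sigma I (\<lambda>i. {..i}). g p) = (\<Sum>i\<in>I. \<Sum>j\<le>i. g (i, j))"
    for g :: "nat \<times> nat \<Rightarrow> real"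
    using assms(7) by (subst sum.Sigma) auto
  have "EK_derivative \<sigma> \<eta> \<mu> f x = (\<Sum>p\<in>Sigma I (\<lambda>i. {..i}).
      \<gamma> p * (Gamma (d p + \<eta> + \<mu> + 1) / Gamma (d p + \<eta> + 1)) * x powr (\<sigma> * d p))"
  proof (rule EK_derivative_powr_sum)
    show "f t = (\<Sum>p\<in>Sigma I (\<lambda>i. {..i}). \<gamma> p * t powr (\<sigma> * d p))" if "t > 0" for t
      unfolding sigma f[OF that] jacobi_muentz1_eq_powr_sum[OF assms(1) that]
      by (simp add: \<gamma>_def d_def sum_distrib_left mult.assoc)
    \<comment> \<open>The left side is \<open>\<beta> - \<mu> + 1\<close> plus a natural number,
      positive since \<open>\<beta> - \<mu> > -1\<close>.\<close>
    show "d p + \<eta> + 1 > 0" for p using assms(5) by (simp add: d_def)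
  qed (use assms in auto)
  also have "\<dots> = (\<Sum>i\<in>I. \<Sum>j\<le>i. c i * (Gamma (real i + \<beta> + 1) / Gamma (real i + \<beta> - \<mu> + 1) *
      (jacobi_coeff i (\<alpha> + \<mu>) (\<beta> - \<mu>) j * b powr (- \<sigma> * real j) * x powr (\<sigma> * (\<beta> - \<eta> - \<mu> + real j)))))"
    unfolding sigma
  proof (intro sum.cong refl)
    fix i j :: nat assume "j \<in> {..i}"
    have G: "Gamma (d (i, j) + \<eta> + \<mu> + 1) / Gamma (d (i, j) + \<eta> + 1) =
        Gamma (real j + \<beta> + 1) / Gamma (real j + \<beta> - \<mu> + 1)"
      by (simp add: d_def algebra_simps)
    have "\<gamma> (i, j) * (Gamma (d (i, j) + \<eta> + \<mu> + 1) / Gamma (d (i, j) + \<eta> + 1)) =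
      c i * b powr (- \<sigma> * real j) * (jacobi_coeff i \<alpha> \<beta> j *
        (Gamma (real j + \<beta> + 1) / Gamma (real j + \<beta> - \<mu> + 1)))"
      unfolding G by (simp add: \<gamma>_def)
    also have "\<dots> = c i * b powr (- \<sigma> * real j) *
        (Gamma (real i + \<beta> + 1) / Gamma (real i + \<beta> - \<mu> + 1) * jacobi_coeff i (\<alpha> + \<mu>) (\<beta> - \<mu>) j)"
      using \<open>j \<in> {..i}\<close> assms(3,5) by (simp only: jacobi_coeff_shift atMost_iff)
    finally show "\<gamma> (i, j) * (Gamma (d (i, j) + \<eta> + \<mu> + 1) / Gamma (d (i, j) + \<eta> + 1)) *
        x powr (\<sigma> * d (i, j)) =
      c i * (Gamma (real i + \<beta> + 1) / Gamma (real i + \<beta> - \<mu> + 1) *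
      (jacobi_coeff i (\<alpha> + \<mu>) (\<beta> - \<mu>) j * b powr (- \<sigma> * real j) * x powr (\<sigma> * (\<beta> - \<eta> - \<mu> + real j))))"
      by (simp add: d_def)
  qed
  also have "\<dots> = (\<Sum>i\<in>I. c i * (Gamma (real i + \<beta> + 1) / Gamma (real i + \<beta> - \<mu> + 1) *
              jacobi_muentz1 b i (\<alpha> + \<mu>) (\<beta> - \<mu>) \<mu> \<sigma> (\<eta> - \<mu>) x))"
    unfolding jacobi_muentz1_eq_powr_sum[OF assms(1,6)]
    by (simp add: sum_distrib_left)
  finally show ?thesis .
qed

lemma jacobi_muentz1_shifted:
  "jacobi_muentz1 b i \<alpha> \<beta> \<mu> \<sigma> \<eta> t =
     t powr (\<sigma> * (\<beta> - \<eta> - \<mu>)) * poly (shifted_jacobi i \<alpha> \<beta>) ((t / b) powr \<sigma>)"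
  by (simp add: jacobi_muentz1_def poly_shifted_jacobi)

text \<open>Once the common power of \<open>t\<close> is taken out, both sides are polynomials in
  \<open>(t / b) powr \<sigma>\<close>, and Lagrange interpolation reproduces
  \<open>q\<close>.\<close>

lemma interpolant1_exact:
  assumes "b > 0" "\<alpha> > -1" "\<beta> > -1" "t > 0"
    and x: "\<And>k. k \<in> {0..N} \<Longrightarrow> x k > 0" and inj: "inj_on (\<lambda>k. (x k / b) powr \<sigma>) {0..N}"
    and v: "\<And>k. k \<in> {0..N} \<Longrightarrow> v (x k) = (\<Sum>i=0..N. c i * jacobi_muentz1 b i \<alpha> \<beta> \<mu> \<sigma> \<eta> (x k))"
  shows "interpolant1 \<beta> \<mu> \<sigma> \<eta> N x v t = (\<Sum>i=0..N. c i * jacobi_muentz1 b i \<alpha> \<beta> \<mu> \<sigma> \<eta> t)"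
proof -
  define e where "e = \<sigma> * (\<beta> - \<eta> - \<mu>)"
  define w where "w k = (x k / b) powr \<sigma>" for k
  define q where "q = (\<Sum>i=0..N. Polynomial.smult (c i) (shifted_jacobi i \<alpha> \<beta>))"
  have q: "(\<Sum>i=0..N. c i * jacobi_muentz1 b i \<alpha> \<beta> \<mu> \<sigma> \<eta> t) = t powr e * poly q ((t / b) powr \<sigma>)" for t
    by (simp add: jacobi_muentz1_shifted q_def e_def poly_sum sum_distrib_left mult_ac)
  have "degree q \<le> N"
    unfolding q_def using degree_shifted_jacobi[OF assms(2,3)]
    by (intro degree_sum_le) (auto intro: order_trans[OF degree_smult_le])
  \<comment> \<open>The Lagrange factors are written without \<open>b\<close>; numerator and
    denominator share the factor \<open>b powr \<sigma>\<close>, which cancels.\<close>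
  have scale: "u powr \<sigma> = b powr \<sigma> * (u / b) powr \<sigma>" if "u > 0" for u
    using that assms(1) by (simp add: powr_divide)
  have "lagrange_muentz \<sigma> N x i t = (\<Prod>j\<in>{0..N} - {i}. ((t / b) powr \<sigma> - w j) / (w i - w j))"
    if i: "i \<in> {0..N}" for i
    unfolding lagrange_muentz_def
  proof (rule prod.cong[OF refl])
    fix j assume "j \<in> {0..N} - {i}"
    then have "t powr \<sigma> - x j powr \<sigma> = b powr \<sigma> * ((t / b) powr \<sigma> - w j)"
      "x i powr \<sigma> - x j powr \<sigma> = b powr \<sigma> * (w i - w j)"
      using scale[OF assms(4)] scale[OF x[of j]] scale[OF x[OF i]]
      by (simp_all add: w_def right_diff_distrib)
    then show "(t powr \<sigma> - x j powr \<sigma>) / (x i powr \<sigma> - x j powr \<sigma>) =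
        ((t / b) powr \<sigma> - w j) / (w i - w j)"
      using assms(1) by simp
  qed
  \<comment> \<open>The nodal value carries \<open>x i powr e\<close>, which the quotient replaces
    by \<open>t powr e\<close>.\<close>
  moreover have "v (x i) * (t / x i) powr e = t powr e * poly q (w i)" if "i \<in> {0..N}" for i
    using x[OF that] assms(4) by (simp add: v[OF that] q w_def powr_divide)
  ultimately have "interpolant1 \<beta> \<mu> \<sigma> \<eta> N x v t = (\<Sum>i=0..N. t powr e *
      (poly q (w i) * (\<Prod>j\<in>{0..N} - {i}. ((t / b) powr \<sigma> - w j) / (w i - w j))))"
    unfolding interpolant1_def e_def[symmetric] by (intro sum.cong) (simp_all add: mult.assoc)
  also have "\<dots> = t powr e * poly q ((t / b) powr \<sigma>)"
    using lagrange_interpolation_exact[OF inj \<open>degree q \<le> N\<close>]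
    by (simp add: sum_distrib_left[symmetric] w_def)
  finally show ?thesis by (simp add: q)
qed

text \<open>A null vector gives a polynomial of degree at most \<open>N\<close> with
  \<open>N + 1\<close> distinct zeros. It vanishes identically, and gradedness forces every entry of
  the vector to be zero.\<close>

lemma jacobi_muentz1_collocation_det:
  assumes "b > 0" "\<alpha> > -1" "\<beta> > -1"
    and x: "\<And>k. k \<in> {0..N} \<Longrightarrow> x k > 0" and inj: "inj_on (\<lambda>k. (x k / b) powr \<sigma>) {0..N}"
  shows "Determinant.det (mat (N + 1) (N + 1) (\<lambda>(k, i). jacobi_muentz1 b i \<alpha> \<beta> \<mu> \<sigma> \<eta> (x k))) \<noteq> 0"
    (is "Determinant.det ?V \<noteq> 0")
proof
  assume "Determinant.det ?V = 0"
  then obtain v where v: "v \<in> carrier_vec (N + 1)" "v \<noteq> 0\<^sub>v (N + 1)" "?V *\<^sub>v v = 0\<^sub>v (N + 1)"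
    using det_0_iff_vec_prod_zero_field[of ?V "N + 1"] by auto
  define q where "q = (\<Sum>i\<le>N. Polynomial.smult (vec_index v i) (shifted_jacobi i \<alpha> \<beta>))"
  have "poly q ((x k / b) powr \<sigma>) = 0" if k: "k \<in> {0..N}" for k
  proof -
    have "0 = vec_index (?V *\<^sub>v v) k" using v(3) k by simp
    also have "\<dots> = (\<Sum>i\<le>N. jacobi_muentz1 b i \<alpha> \<beta> \<mu> \<sigma> \<eta> (x k) * vec_index v i)"
      using k v(1) by (simp add: scalar_prod_def lessThan_Suc_atMost[symmetric] atLeast0LessThan)
    also have "\<dots> = x k powr (\<sigma> * (\<beta> - \<eta> - \<mu>)) * poly q ((x k / b) powr \<sigma>)"
      by (simp add: jacobi_muentz1_shifted q_def poly_sum sum_distrib_left mult_ac)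
    finally show ?thesis using x[OF k] by simp
  qed
  moreover have "degree q \<le> N"
    unfolding q_def using degree_shifted_jacobi[OF assms(2,3)]
    by (intro degree_sum_le) (auto intro: order_trans[OF degree_smult_le])
  moreover have "card ((\<lambda>k. (x k / b) powr \<sigma>) ` {0..N}) = Suc N"
    using card_image[OF inj] by simp
  ultimately have "q = 0"
    by (intro poly_eqI_degree[where A = "(\<lambda>k. (x k / b) powr \<sigma>) ` {0..N}"]) auto
  then have "vec_index v i = 0" if "i \<le> N" for i
    using graded_polys_independent[of N "\<lambda>i. shifted_jacobi i \<alpha> \<beta>" "vec_index v", OF _ _ _ that]
      degree_shifted_jacobi[OF assms(2,3)] shifted_jacobi_nonzero[OF assms(2,3)]
    by (simp add: q_def)
  then have "v = 0\<^sub>v (N + 1)" using v(1) by (intro eq_vecI) auto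
  then show False using v(2) by simp
qed

section \<open>Matrix inversion and the differentiation matrix\<close>

lemma mat_inverse_of_det_nonzero:
  fixes A :: "'a :: field mat"
  assumes "A \<in> carrier_mat n n" "Determinant.det A \<noteq> 0"
  shows "invertible_mat A" "A * the (mat_inverse A) = 1\<^sub>m n" "the (mat_inverse A) \<in> carrier_mat n n"
proof -
  have "A \<in> Units (ring_mat TYPE('a) n ())" using assms by (rule det_non_zero_imp_unit)
  \<comment> \<open>\<open>mat_inverse\<close> returns an option; membership in the group of units
    excludes \<open>None\<close>.\<close>
  then have "mat_inverse A \<noteq> None"
    using mat_inverse(1)[OF assms(1), where b = "()"] by blast
  then obtain B where B: "mat_inverse A = Some B" by blast
  note inv = mat_inverse(2)[OF assms(1) B]
  then show "invertible_mat A"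
    using assms(1) by (auto simp: invertible_mat_def inverts_mat_def square_mat.simps)
  show "A * the (mat_inverse A) = 1\<^sub>m n" "the (mat_inverse A) \<in> carrier_mat n n"
    using inv B by simp_all
qed

lemma mat_mult_entry:
  assumes "A \<in> carrier_mat (N + 1) (N + 1)" "B \<in> carrier_mat (N + 1) (N + 1)" "i \<le> N" "k \<le> N"
  shows "(A * B) $$ (i, k) = (\<Sum>j=0..N. A $$ (i, j) * B $$ (j, k))"
proof -
  have "(A * B) $$ (i, k) = (\<Sum>j=0..<N + 1. A $$ (i, j) * B $$ (j, k))"
    using assms by (auto simp: scalar_prod_def intro!: sum.cong)
  then show ?thesis by (simp only: Suc_eq_plus1[symmetric] atLeastLessThanSuc_atLeastAtMost)
qed

text \<open>The equivalence says both that \<open>U * the (mat_inverse V)\<close> represents the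
  derivative of the interpolant at the nodes and that no other matrix does.\<close>

theorem theorem3p20:
  fixes b \<sigma> \<alpha> \<beta> \<eta> \<mu> :: real and N :: nat
    and z x :: "nat \<Rightarrow> real" and V U :: "real mat"
  assumes "b > 0" and "\<sigma> > 0" and "\<alpha> > -1" and "\<beta> > -1" and "\<mu> > 0" and "\<beta> - \<mu> > -1"
    and gauss_jacobi_nodes:
      "z ` {0..N} = {y \<in> {-1<..<1}. poly (jacobi_poly (N + 1) \<alpha> \<beta>) y = 0}"
    and mapped_nodes: "\<forall>r\<in>{0..N}. x r = b * ((1 + z r) / 2) powr (1 / \<sigma>)"
    and V: "V = mat (N + 1) (N + 1) (\<lambda>(k, i). jacobi_muentz1 b i \<alpha> \<beta> \<mu> \<sigma> \<eta> (x k))"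
    and U: "U = mat (N + 1) (N + 1) (\<lambda>(k, i).
              Gamma (real i + \<beta> + 1) / Gamma (real i + \<beta> - \<mu> + 1) *
              jacobi_muentz1 b i (\<alpha> + \<mu>) (\<beta> - \<mu>) \<mu> \<sigma> (\<eta> - \<mu>) (x k))"
  shows "invertible_mat V \<and>
    (\<forall>D \<in> carrier_mat (N + 1) (N + 1).
       (\<forall>v. continuous_on {0<..<b} v \<longrightarrow>
          (\<forall>k\<in>{0..N}. EK_derivative \<sigma> \<eta> \<mu> (interpolant1 \<beta> \<mu> \<sigma> \<eta> N x v) (x k) =
             (\<Sum>i=0..N. D $$ (k, i) * v (x i))))
       \<longleftrightarrow> D = U * the (mat_inverse V))"
proof -
  \<comment> \<open>The indices \<open>0..N\<close> enumerate a set with at least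
    \<open>N + 1\<close> elements, so no zero is repeated.\<close>
  have inj_z: "inj_on z {0..N}"
  proof -
    obtain Z where Z: "finite Z" "card Z = N + 1" "Z \<subseteq> {0<..<1}"
      "\<forall>y\<in>Z. poly (jacobi_poly (N + 1) \<alpha> \<beta>) (2 * y - 1) = 0"
      using jacobi_poly_unit_zeros[OF assms(3,4)] by blast
    have "(\<lambda>y. 2 * y - 1) ` Z \<subseteq> z ` {0..N}"
      unfolding gauss_jacobi_nodes using Z(3,4) by auto
    then have "card ((\<lambda>y. 2 * y - 1) ` Z) \<le> card (z ` {0..N})" by (intro card_mono) auto
    moreover have "card ((\<lambda>y. 2 * y - 1) ` Z) = N + 1"
      using Z(2) by (subst card_image) (auto simp: inj_on_def)
    moreover have "card (z ` {0..N}) \<le> N + 1" using card_image_le[of "{0..N}" z] by simp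
    ultimately show ?thesis by (intro eq_card_imp_inj_on) auto
  qed
  have z: "-1 < z k" "z k < 1" if "k \<in> {0..N}" for k
    using gauss_jacobi_nodes that by auto
  \<comment> \<open>The mapping of the nodes is undone by \<open>(x k / b) powr \<sigma>\<close>, so
    the unit-variable nodes inherit distinctness from \<open>z\<close>.\<close>
  have x_pos: "x k > 0" and x_unit: "(x k / b) powr \<sigma> = (1 + z k) / 2" if "k \<in> {0..N}" for k
    using mapped_nodes that z[OF that] assms(1,2) by (auto simp: powr_powr)
  have inj_w: "inj_on (\<lambda>k. (x k / b) powr \<sigma>) {0..N}"
    using inj_z by (auto simp: inj_on_def x_unit)
  have inj_x: "inj_on x {0..N}"
    using inj_w by (auto simp: inj_on_def)
  define B where "B = the (mat_inverse V)"
  have Vc: "V \<in> carrier_mat (N + 1) (N + 1)" and Uc: "U \<in> carrier_mat (N + 1) (N + 1)"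
    by (simp_all add: V U)
  have "Determinant.det V \<noteq> 0"
    unfolding V by (rule jacobi_muentz1_collocation_det[OF assms(1,3,4) x_pos inj_w])
  note Vinv = mat_inverse_of_det_nonzero[OF Vc this, folded B_def]
  define W where "W = U * B"
  have Wc: "W \<in> carrier_mat (N + 1) (N + 1)" using Uc Vinv(3) by (simp add: W_def)
  have EK: "EK_derivative \<sigma> \<eta> \<mu> (interpolant1 \<beta> \<mu> \<sigma> \<eta> N x v) (x k) = (\<Sum>i=0..N. W $$ (k, i) * v (x i))"
    if k: "k \<in> {0..N}" for v k
  proof -
    \<comment> \<open>These coefficients solve the collocation system: \<open>V\<close> applied to
      \<open>c\<close> returns the nodal values of \<open>v\<close>.\<close>
    define c where "c i = (\<Sum>l=0..N. B $$ (i, l) * v (x l))" for i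
    have "v (x r) = (\<Sum>i=0..N. c i * jacobi_muentz1 b i \<alpha> \<beta> \<mu> \<sigma> \<eta> (x r))" if r: "r \<in> {0..N}" for r
    proof -
      have "(\<Sum>i=0..N. c i * jacobi_muentz1 b i \<alpha> \<beta> \<mu> \<sigma> \<eta> (x r)) = (\<Sum>i=0..N. \<Sum>l=0..N. V $$ (r, i) * B $$ (i, l) * v (x l))"
        using r unfolding c_def V
        by (intro sum.cong) (simp_all add: sum_distrib_right sum_distrib_left mult_ac)
      also have "\<dots> = (\<Sum>l=0..N. (V * B) $$ (r, l) * v (x l))"
        using r by (subst sum.swap, intro sum.cong) (simp_all add: mat_mult_entry[OF Vc Vinv(3)] sum_distrib_right)
      also have "\<dots> = (\<Sum>l=0..N. if l = r then v (x l) else 0)"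
        using r by (intro sum.cong) (auto simp: Vinv(2))
      finally show ?thesis using r by simp
    qed
    then have "interpolant1 \<beta> \<mu> \<sigma> \<eta> N x v t = (\<Sum>i=0..N. c i * jacobi_muentz1 b i \<alpha> \<beta> \<mu> \<sigma> \<eta> t)" if "t > 0" for t
      by (intro interpolant1_exact[OF assms(1,3,4) that x_pos inj_w])
    then have "EK_derivative \<sigma> \<eta> \<mu> (interpolant1 \<beta> \<mu> \<sigma> \<eta> N x v) (x k) =
        (\<Sum>i=0..N. c i * (Gamma (real i + \<beta> + 1) / Gamma (real i + \<beta> - \<mu> + 1) *
              jacobi_muentz1 b i (\<alpha> + \<mu>) (\<beta> - \<mu>) \<mu> \<sigma> (\<eta> - \<mu>) (x k)))"
      by (intro EK_derivative_jacobi_muentz1_sum[OF assms(1,2,4,5,6) x_pos[OF k]]) auto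
    \<comment> \<open>The entries of \<open>U\<close> are the derivatives of the basis functions at
      the nodes, so the result is \<open>U * B\<close> applied to the nodal values.\<close>
    also have "\<dots> = (\<Sum>i=0..N. \<Sum>l=0..N. U $$ (k, i) * B $$ (i, l) * v (x l))"
      using k unfolding c_def U sum_distrib_right
      by (intro sum.cong refl) simp
    also have "\<dots> = (\<Sum>l=0..N. W $$ (k, l) * v (x l))"
      using k by (subst sum.swap, intro sum.cong)
        (simp_all add: W_def mat_mult_entry[OF Uc Vinv(3)] sum_distrib_right)
    finally show ?thesis .
  qed
  have unique: "D = W" if D: "D \<in> carrier_mat (N + 1) (N + 1)"
    and eq: "\<And>v k. continuous_on {0<..<b} v \<Longrightarrow> k \<in> {0..N} \<Longrightarrow>
      EK_derivative \<sigma> \<eta> \<mu> (interpolant1 \<beta> \<mu> \<sigma> \<eta> N x v) (x k) = (\<Sum>i=0..N. D $$ (k, i) * v (x i))" for D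
  proof (rule eq_matI)
    fix k l assume "k < dim_row W" "l < dim_col W"
    then have k: "k \<in> {0..N}" and l: "l \<in> {0..N}" using Wc by auto
    \<comment> \<open>The test function is the Lagrange polynomial in \<open>t\<close> itself, equal
      to \<open>1\<close> at \<open>x l\<close> and \<open>0\<close> at the other nodes. It is
      continuous and picks out the entry in row \<open>k\<close> and column \<open>l\<close> of both
      matrices.\<close>
    define v where "v t = (\<Prod>j\<in>{0..N} - {l}. (t - x j) / (x l - x j))" for t
    have delta: "(\<Sum>i=0..N. M $$ (k, i) * v (x i)) = M $$ (k, l)" for M :: "real mat"
    proof -
      have "(\<Sum>i=0..N. M $$ (k, i) * v (x i)) = (\<Sum>i=0..N. if l = i then M $$ (k, i) else 0)"
      proof (rule sum.cong[OF refl])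
        fix i assume "i \<in> {0..N}"
        from lagrange_basis_node[OF inj_x l this, folded v_def]
        show "M $$ (k, i) * v (x i) = (if l = i then M $$ (k, i) else 0)" by simp
      qed
      then show ?thesis using l by (simp only: sum.delta' finite_atLeastAtMost if_True)
    qed
    have "continuous_on {0<..<b} v"
      unfolding v_def using inj_x l by (intro continuous_intros) (auto simp: inj_on_def)
    from eq[OF this k] show "D $$ (k, l) = W $$ (k, l)"
      unfolding EK[OF k] delta by simp
  qed (use D Wc in auto)
  show ?thesis
    unfolding B_def[symmetric] W_def[symmetric]
  proof (intro conjI ballI iffI)
    show "invertible_mat V" by (rule Vinv(1))
  next
    fix D :: "real mat"
    assume D: "D \<in> carrier_mat (N + 1) (N + 1)"
    assume "\<forall>v. continuous_on {0<..<b} v \<longrightarrow>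
      (\<forall>k\<in>{0..N}. EK_derivative \<sigma> \<eta> \<mu> (interpolant1 \<beta> \<mu> \<sigma> \<eta> N x v) (x k) =
        (\<Sum>i=0..N. D $$ (k, i) * v (x i)))"
    from unique[OF D this[rule_format]] show "D = W" .
  next
    fix D :: "real mat"
    assume "D = W"
    show "\<forall>v. continuous_on {0<..<b} v \<longrightarrow>
      (\<forall>k\<in>{0..N}. EK_derivative \<sigma> \<eta> \<mu> (interpolant1 \<beta> \<mu> \<sigma> \<eta> N x v) (x k) =
        (\<Sum>i=0..N. D $$ (k, i) * v (x i)))"
      unfolding \<open>D = W\<close> by (intro allI impI ballI EK)
  qed
qed

end
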